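(* Let $f=\sec(2x)$, $g=2\tan(2x)$, $h=\tan(2x)$, and $D=d/dx$. For every integer $n\ge0$, $$D^n(f)=2^n f\,Q_n(h),\qquad D^n(g)=2^{n+1}P_n(h).$$
   Context: The polynomials $P_n,Q_n$ are the derivative polynomials of tangent and secant, defined by $P_0(u)=u$, $P_{n+1}(u)=(1+u^2)P_n'(u)$ and $Q_0(u)=1$, $Q_{n+1}(u)=(1+u^2)Q_n'(u)+uQ_n(u)$. Functions are considered where $\cos 2x\ne0$. *)

theory Defs
  imports "HOL-Analysis.Analysis" "HOL-Computational_Algebra.Polynomial"
begin

definition sec :: "real \<Rightarrow> real" where
  "sec x = 1 / cos x"

text \<open>Below, \<open>[:0, 1:]\<close> is the indeterminate \<open>u\<close>.\<close>

primrec tan_deriv_poly :: "nat \<Rightarrow> real poly" where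
  "tan_deriv_poly 0 = [:0, 1:]"
| "tan_deriv_poly (Suc n) = (1 + [:0, 1:]\<^sup>2) * pderiv (tan_deriv_poly n)"

primrec sec_deriv_poly :: "nat \<Rightarrow> real poly" where
  "sec_deriv_poly 0 = 1"
| "sec_deriv_poly (Suc n) =
    (1 + [:0, 1:]\<^sup>2) * pderiv (sec_deriv_poly n) + [:0, 1:] * sec_deriv_poly n"

end

theory Submission
  imports Defs
begin

text \<open>Put u = tan(2x), so that u' = 2(1 + u^2) and sec(2x)' = 2 sec(2x) u. Differentiating
  p(u) therefore gives 2(1 + u^2) p'(u), and differentiating sec(2x) p(u) gives 2 sec(2x) ((1 + u^2)
  p'(u) + u p(u)): up to the factor 2, these are the two recurrences. So each closed form
  differentiates to the next one, and \<open>has_field_derivative_funpow_deriv\<close> turns such a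
  chain of functions into a statement about iterated \<open>deriv\<close>.\<close>

lemma has_field_derivative_funpow_deriv:
  fixes F :: "nat \<Rightarrow> 'a::real_normed_field \<Rightarrow> 'a"
  assumes "open S"
    and F: "\<And>n x. x \<in> S \<Longrightarrow> (F n has_field_derivative F (Suc n) x) (at x)"
    and "x \<in> S"
  shows "(deriv ^^ n) (F 0) x = F n x"
    and "((deriv ^^ n) (F 0) has_field_derivative F (Suc n) x) (at x)"
proof -
  \<comment> \<open>A derivative depends on values near the point, so agreement with
    \<open>F n\<close> is needed on all of the open set \<open>S\<close>; the induction for
    \<open>eq\<close> therefore quantifies over \<open>S\<close>.\<close>
  have D: "((deriv ^^ n) (F 0) has_field_derivative F (Suc n) y) (at y)"
    if "\<forall>z\<in>S. (deriv ^^ n) (F 0) z = F n z" "y \<in> S" for n y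
    using has_field_derivative_transform_within_open[OF F \<open>open S\<close>] that by simp
  have eq: "\<forall>y\<in>S. (deriv ^^ n) (F 0) y = F n y" for n
    by (induction n) (auto intro: DERIV_imp_deriv D)
  show "(deriv ^^ n) (F 0) x = F n x"
    and "((deriv ^^ n) (F 0) has_field_derivative F (Suc n) x) (at x)"
    using eq D \<open>x \<in> S\<close> by blast+
qed

lemma tan_double_has_field_derivative:
  fixes x :: real
  assumes "cos (2 * x) \<noteq> 0"
  shows "((\<lambda>x. tan (2 * x)) has_field_derivative 2 * (1 + (tan (2 * x))\<^sup>2)) (at x)"
proof -
  \<comment> \<open>The library derivative of \<open>tan\<close> is in terms of the cosine; this
    identity gives the factor 1 + u^2 of the recurrences.\<close>
  have "1 + (tan (2 * x))\<^sup>2 = inverse ((cos (2 * x))\<^sup>2)"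
    using assms by (simp add: tan_sec power_inverse)
  then show ?thesis
    using assms by (auto intro!: derivative_eq_intros)
qed

lemma sec_double_has_field_derivative:
  assumes "cos (2 * x) \<noteq> 0"
  shows "((\<lambda>x. sec (2 * x)) has_field_derivative 2 * sec (2 * x) * tan (2 * x)) (at x)"
  unfolding sec_def using assms
  by (auto intro!: derivative_eq_intros simp: tan_def power2_eq_square field_simps)

theorem proposition2:
  fixes f g h :: "real \<Rightarrow> real" and n :: nat and x :: real
  assumes "f = (\<lambda>x. sec (2 * x))"
    and "g = (\<lambda>x. 2 * tan (2 * x))"
    and "h = (\<lambda>x. tan (2 * x))"
    and "cos (2 * x) \<noteq> 0"
  shows "(deriv ^^ n) f differentiable (at x) \<and>
         (deriv ^^ n) g differentiable (at x) \<and>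
         (deriv ^^ n) f x = 2 ^ n * f x * poly (sec_deriv_poly n) (h x) \<and>
         (deriv ^^ n) g x = 2 ^ (n + 1) * poly (tan_deriv_poly n) (h x)"
proof -
  define S where "S = {x::real. cos (2 * x) \<noteq> 0}"
  define F where "F n x = 2 ^ n * sec (2 * x) * poly (sec_deriv_poly n) (tan (2 * x))" for n x
  define G where "G n x = 2 ^ (n + 1) * poly (tan_deriv_poly n) (tan (2 * x))" for n and x :: real
  have "open S"
    unfolding S_def by (intro open_Collect_neq continuous_intros)
  have "x \<in> S"
    using assms(4) by (simp add: S_def)
  have f: "f = F 0" and g: "g = G 0"
    by (auto simp: assms F_def G_def)
  have dp: "((\<lambda>x. poly p (tan (2 * x))) has_field_derivative
      poly (pderiv p) (tan (2 * x)) * (2 * (1 + (tan (2 * x))\<^sup>2))) (at x)"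
    if "x \<in> S" for p and x :: real
    using DERIV_chain2[OF poly_DERIV tan_double_has_field_derivative] that by (simp add: S_def)
  have dF: "(F n has_field_derivative F (Suc n) x) (at x)" if "x \<in> S" for n x
    unfolding F_def
    \<comment> \<open>In the product rule, the secant factor yields the term u Q_n and the
      polynomial factor yields (1 + u^2) Q_n'.\<close>
    by (rule DERIV_cong[OF DERIV_mult[OF DERIV_cmult[OF sec_double_has_field_derivative] dp]])
      (use that in \<open>simp_all add: S_def algebra_simps\<close>)
  have dG: "(G n has_field_derivative G (Suc n) x) (at x)" if "x \<in> S" for n x
    unfolding G_def
    by (rule DERIV_cong[OF DERIV_cmult[OF dp[OF that]]]) (simp add: algebra_simps)
  note F = has_field_derivative_funpow_deriv[of S F, OF \<open>open S\<close> dF \<open>x \<in> S\<close>]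
    and G = has_field_derivative_funpow_deriv[of S G, OF \<open>open S\<close> dG \<open>x \<in> S\<close>]
  \<comment> \<open>Since \<open>deriv\<close> is total, differentiability is shown separately, so
    that the values are genuine derivatives.\<close>
  have "(deriv ^^ n) f differentiable (at x)" "(deriv ^^ n) g differentiable (at x)"
    unfolding f g using F(2) G(2) by (auto simp: real_differentiable_def)
  moreover have "(deriv ^^ n) f x = F n x" "(deriv ^^ n) g x = G n x"
    unfolding f g using F(1) G(1) by blast+
  ultimately show ?thesis
    by (simp add: F_def G_def assms(1,3))
qed

end
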